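(* Let $G=\langle X\rangle$ be a group with finite inverse-closed generating set $X$. If the language $\mathsf{Geo}(G,X)$ is regular, then the language $\mathsf{CycGeo}(G,X)$ is regular.
   Context: $X^*$ is the set of all words over the finite alphabet $X$, $l(w)$ is the length of a word $w$, and $\pi:X^*\to G$ is the natural projection. For $g\in G$, $|g|$ is the length of a shortest word over $X$ representing $g$. A word $w$ is geodesic if $l(w)=|\pi(w)|$; $\mathsf{Geo}(G,X)$ is the set of all geodesic words. $\mathsf{CycGeo}(G,X)$ is the set of all words $w\in X^*$ such that every cyclic permutation of $w$ is geodesic. A language is regular if it is accepted by a finite state automaton. *)

theory Defs
  imports "HOL-Algebra.Generated_Groups"
begin

section \<open>Regular languages\<close>

text \<open>Deterministic, complete finite state automata over an alphabet \<open>X\<close>. Only the values of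
  \<open>trans\<close> on \<open>states\<close> and \<open>X\<close> matter.\<close>

record ('s, 'x) automaton =
  states :: "'s set"
  start :: 's
  accepting :: "'s set"
  trans :: "'s \<Rightarrow> 'x \<Rightarrow> 's"

definition finite_state_automaton :: "'x set \<Rightarrow> ('s, 'x) automaton \<Rightarrow> bool" where
  "finite_state_automaton X A \<longleftrightarrow>
     finite X \<and> finite (states A) \<and> start A \<in> states A \<and> accepting A \<subseteq> states A \<and>
     (\<forall>q\<in>states A. \<forall>x\<in>X. trans A q x \<in> states A)"

definition accepted_language :: "'x set \<Rightarrow> ('s, 'x) automaton \<Rightarrow> 'x list set" where
  "accepted_language X A = {w \<in> lists X. foldl (trans A) (start A) w \<in> accepting A}"

text \<open>HOL cannot quantify existentially over the type of states, so the states are taken to be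
  natural numbers; \<open>regular_languageI\<close> shows that this is no restriction.\<close>

definition regular_language :: "'x set \<Rightarrow> 'x list set \<Rightarrow> bool" where
  "regular_language X L \<longleftrightarrow>
     (\<exists>A :: (nat, 'x) automaton. finite_state_automaton X A \<and> accepted_language X A = L)"

lemma regular_languageI:
  fixes A :: "('s, 'x) automaton"
  assumes A: "finite_state_automaton X A"
  shows "regular_language X (accepted_language X A)"
proof -
  from A have fin: "finite (states A)" and st: "start A \<in> states A"
    and ac: "accepting A \<subseteq> states A" and fX: "finite X"
    and cl: "\<And>q x. q \<in> states A \<Longrightarrow> x \<in> X \<Longrightarrow> trans A q x \<in> states A"
    by (auto simp: finite_state_automaton_def)
  obtain f :: "'s \<Rightarrow> nat" where f: "inj_on f (states A)"
    using finite_imp_inj_to_nat_seg[OF fin] by blast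
  define g where "g = the_inv_into (states A) f"
  have g: "g (f q) = q" if "q \<in> states A" for q
    using f that by (simp add: g_def the_inv_into_f_f)
  define B where "B = \<lparr>states = f ` states A, start = f (start A), accepting = f ` accepting A,
    trans = (\<lambda>n x. f (trans A (g n) x))\<rparr>"
  have run: "foldl (trans B) (f q) w = f (foldl (trans A) q w) \<and> foldl (trans A) q w \<in> states A"
    if "q \<in> states A" "w \<in> lists X" for q w
    using that(2,1) by (induction w arbitrary: q) (auto simp: B_def g cl)
  have "finite_state_automaton X B"
    using fin st ac fX by (auto simp: finite_state_automaton_def B_def g cl)
  moreover have "accepted_language X B = accepted_language X A"
  proof -
    have "foldl (trans B) (start B) w \<in> accepting B \<longleftrightarrow> foldl (trans A) (start A) w \<in> accepting A"
      if "w \<in> lists X" for w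
    proof -
      have *: "foldl (trans B) (start B) w = f (foldl (trans A) (start A) w)"
        "foldl (trans A) (start A) w \<in> states A"
        using run[OF st that] by (simp_all add: B_def)
      show ?thesis
        using f ac *(2) unfolding *(1) by (auto simp: B_def inj_on_image_mem_iff)
    qed
    then show ?thesis by (auto simp: accepted_language_def)
  qed
  ultimately show ?thesis unfolding regular_language_def by blast
qed


section \<open>Geodesic words\<close>

definition word_value :: "('a, 'b) monoid_scheme \<Rightarrow> 'a list \<Rightarrow> 'a" where
  "word_value G w = foldr (\<otimes>\<^bsub>G\<^esub>) w \<one>\<^bsub>G\<^esub>"

text \<open>Meaningful only for elements of the subgroup generated by \<open>X\<close>, where the set of lengths is
  nonempty (for inverse-closed \<open>X\<close>).\<close>

definition word_norm :: "('a, 'b) monoid_scheme \<Rightarrow> 'a set \<Rightarrow> 'a \<Rightarrow> nat" where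
  "word_norm G X g = (LEAST n. \<exists>w\<in>lists X. word_value G w = g \<and> length w = n)"

definition Geo :: "('a, 'b) monoid_scheme \<Rightarrow> 'a set \<Rightarrow> 'a list set" where
  "Geo G X = {w \<in> lists X. length w = word_norm G X (word_value G w)}"

definition CycGeo :: "('a, 'b) monoid_scheme \<Rightarrow> 'a set \<Rightarrow> 'a list set" where
  "CycGeo G X = {w \<in> lists X. \<forall>n. rotate n w \<in> Geo G X}"

end

theory Submission
  imports Defs
begin

text \<open>Geodesics play no role: for every regular language \<open>L\<close>, the words all of whose cyclic
  permutations lie in \<open>L\<close> form a regular language. Let \<open>f\<^sub>w\<close> be the map on the states of an
  automaton for \<open>L\<close> induced by reading \<open>w\<close>, and \<open>s\<close> its start state. A cyclic permutation
  \<open>v @ u\<close> of \<open>w = u @ v\<close> lies in \<open>L\<close> iff \<open>f\<^sub>u (f\<^sub>v s)\<close> is accepting, so it suffices to compute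
  \<open>f\<^sub>w\<close> and the set of all pairs \<open>(f\<^sub>u, f\<^sub>v s)\<close> with \<open>u @ v = w\<close>. There are only finitely many
  possible values, and both are easily updated when a letter is appended.\<close>

text \<open>Rotation by \<open>n\<close> moves the prefix \<open>take (n mod length w) w\<close> to
  the end; conversely, \<open>v @ u\<close> is the rotation of \<open>u @ v\<close> by
  \<open>length u\<close>.\<close>

lemma all_rotate_iff: "(\<forall>n. rotate n w \<in> L) \<longleftrightarrow> (\<forall>u v. w = u @ v \<longrightarrow> v @ u \<in> L)"
  by (metis append_take_drop_id rotate_append rotate_drop_take)

text \<open>Maps are cut down by \<open>restrict\<close> to extensional ones, so that
  \<open>E\<close> is finite when \<open>Q\<close> is.\<close>

definition rotation_automaton ::
    "('s, 'x) automaton \<Rightarrow> (('s \<Rightarrow> 's) \<times> (('s \<Rightarrow> 's) \<times> 's) set, 'x) automaton" where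
  "rotation_automaton A = (let Q = states A; E = Q \<rightarrow>\<^sub>E Q; i = restrict id Q in
     \<lparr>states = E \<times> Pow (E \<times> Q),
      start = (i, {(i, start A)}),
      accepting = E \<times> Pow {(g, q) \<in> E \<times> Q. g q \<in> accepting A},
      trans = (\<lambda>(g, S) x. let h = restrict (\<lambda>q. trans A (g q) x) Q
        in (h, insert (h, start A) ((\<lambda>(a, b). (a, trans A b x)) ` S)))\<rparr>)"

lemma finite_state_automaton_rotation:
  assumes "finite_state_automaton X A"
  shows "finite_state_automaton X (rotation_automaton A)"
  using assms
  by (auto simp: finite_state_automaton_def rotation_automaton_def Let_def finite_PiE
      PiE_iff subset_iff split: if_splits)

lemma foldl_trans_in_states:
  assumes "finite_state_automaton X A" "w \<in> lists X" "q \<in> states A"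
  shows "foldl (trans A) q w \<in> states A"
  using assms(2,3,1)
  by (induction w arbitrary: q) (auto simp: finite_state_automaton_def)

text \<open>Matches the transition: the first case is the inserted pair, and in the second an old
  cut keeps its \<open>u\<close>, so only the second component of its pair moves.\<close>

lemma split_snoc_iff: "w @ [x] = u @ v \<longleftrightarrow> (u = w @ [x] \<and> v = []) \<or> (\<exists>v'. v = v' @ [x] \<and> w = u @ v')"
  by (cases v rule: rev_cases) auto

lemma foldl_trans_rotation:
  fixes A :: "('s, 'x) automaton"
  defines "f \<equiv> \<lambda>w. restrict (\<lambda>q. foldl (trans A) q w) (states A)"
  shows "foldl (trans (rotation_automaton A)) (start (rotation_automaton A)) w =
    (f w, {(f u, foldl (trans A) (start A) v) | u v. w = u @ v})"
proof (induction w rule: rev_induct)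
  case Nil
  then show ?case by (auto simp: rotation_automaton_def f_def Let_def id_def)
next
  case (snoc x w)
  have f: "restrict (\<lambda>q. trans A (f w q) x) (states A) = f (w @ [x])"
    by (auto simp: f_def restrict_def)
  have step: "trans (rotation_automaton A) (f w, S) x =
      (f (w @ [x]), insert (f (w @ [x]), start A) ((\<lambda>(a, b). (a, trans A b x)) ` S))" for S
    by (simp add: rotation_automaton_def Let_def f)
  have "insert (f (w @ [x]), start A) ((\<lambda>(a, b). (a, trans A b x)) `
        {(f u, foldl (trans A) (start A) v) | u v. w = u @ v}) =
      {(f u, foldl (trans A) (start A) v) | u v. w @ [x] = u @ v}" (is "?L = ?R")
  proof
    show "?L \<subseteq> ?R" unfolding split_snoc_iff by fastforce
    show "?R \<subseteq> ?L" unfolding split_snoc_iff by (fastforce simp: image_iff)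
  qed
  then show ?case by (simp add: snoc step)
qed

lemma accepted_language_rotation:
  assumes A: "finite_state_automaton X A"
  shows "accepted_language X (rotation_automaton A) =
    {w \<in> lists X. \<forall>n. rotate n w \<in> accepted_language X A}"
proof -
  define f where "f w = restrict (\<lambda>q. foldl (trans A) q w) (states A)" for w
  have fE: "f w \<in> states A \<rightarrow>\<^sub>E states A" if "w \<in> lists X" for w
    using foldl_trans_in_states[OF A that] by (simp add: f_def)
  have st: "foldl (trans A) (start A) w \<in> states A" if "w \<in> lists X" for w
    using foldl_trans_in_states[OF A that] A by (simp add: finite_state_automaton_def)
  have "foldl (trans (rotation_automaton A)) (start (rotation_automaton A)) w
      \<in> accepting (rotation_automaton A)
    \<longleftrightarrow> (\<forall>u v. w = u @ v \<longrightarrow> v @ u \<in> accepted_language X A)" if w: "w \<in> lists X" for w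
  proof -
    \<comment> \<open>The membership conjuncts come from \<open>E \<times> Q\<close> in
      \<open>accepting\<close>; they hold for every cut of a word over \<open>X\<close>.\<close>
    have "foldl (trans (rotation_automaton A)) (start (rotation_automaton A)) w
        \<in> accepting (rotation_automaton A)
      \<longleftrightarrow> (\<forall>u v. w = u @ v \<longrightarrow> f u \<in> states A \<rightarrow>\<^sub>E states A \<and> foldl (trans A) (start A) v \<in> states A
            \<and> f u (foldl (trans A) (start A) v) \<in> accepting A)"
      unfolding foldl_trans_rotation f_def[symmetric]
      using fE[OF w] by (auto simp: rotation_automaton_def Let_def)
    also have "\<dots> \<longleftrightarrow> (\<forall>u v. w = u @ v \<longrightarrow> v @ u \<in> accepted_language X A)"
    proof (intro iff_allI imp_cong refl)
      fix u v assume "w = u @ v"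
      with w have "u \<in> lists X" "v \<in> lists X" by auto
      then show "(f u \<in> states A \<rightarrow>\<^sub>E states A \<and> foldl (trans A) (start A) v \<in> states A
            \<and> f u (foldl (trans A) (start A) v) \<in> accepting A)
          \<longleftrightarrow> v @ u \<in> accepted_language X A"
        \<comment> \<open>By \<open>st\<close> the state reached by \<open>v\<close> lies in
          \<open>states A\<close>, where \<open>f u\<close> is the run on \<open>u\<close> and not
          \<open>undefined\<close>.\<close>
        using fE[of u] st[of v] by (simp add: accepted_language_def f_def)
    qed
    finally show ?thesis .
  qed
  then show ?thesis
    unfolding all_rotate_iff accepted_language_def[of _ "rotation_automaton A"] by blast
qed

lemma regular_language_rotations:
  fixes L :: "'x list set"
  assumes "regular_language X L"
  shows "regular_language X {w \<in> lists X. \<forall>n. rotate n w \<in> L}"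
proof -
  obtain A :: "(nat, 'x) automaton"
    where A: "finite_state_automaton X A" and L: "accepted_language X A = L"
    using assms by (auto simp: regular_language_def)
  show ?thesis
    \<comment> \<open>The states here are not naturals; \<open>regular_languageI\<close> renames
      them.\<close>
    using regular_languageI[OF finite_state_automaton_rotation[OF A]]
    by (simp add: accepted_language_rotation[OF A] L)
qed

theorem proposition2p2:
  fixes G :: "('a, 'b) monoid_scheme" and X :: "'a set"
  assumes "group G"
    and "finite X" and "X \<subseteq> carrier G"
    and "\<And>x. x \<in> X \<Longrightarrow> inv\<^bsub>G\<^esub> x \<in> X"
    and "generate G X = carrier G"
    and "regular_language X (Geo G X)"
  shows "regular_language X (CycGeo G X)"
  using regular_language_rotations[OF assms(6)] by (simp add: CycGeo_def)

end
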